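(* Suppose $(S,\to,\twoheadrightarrow,\hookrightarrow)$ is a finite two-acyclic factorization system. Then $\operatorname{Pairs}(\to)$ is congruence uniform if and only if $\rightsquigarrow$ is acyclic.
   Context: For a binary relation $\to$ on a set $S$ and $X\subseteq S$, put $X^\perp=\{y\in S: x\not\to y\ \forall x\in X\}$ and ${}^\perp X=\{y\in S: y\not\to x\ \forall x\in X\}$. A maximal orthogonal pair is a pair $(X,Y)$ of subsets of $S$ with $Y=X^\perp$ and $X={}^\perp Y$. $\operatorname{Pairs}(\to)$ is the complete lattice of maximal orthogonal pairs, partially ordered by containment of first components. For a reflexive relation $\to$ on $S$, $\operatorname{Fact}(\to)=(\twoheadrightarrow,\hookrightarrow)$, where $x\twoheadrightarrow y$ iff for all $z$, $y\to z$ implies $x\to z$, and $x\hookrightarrow y$ iff for all $z$, $z\to x$ implies $z\to y$. For preorders $\twoheadrightarrow,\hookrightarrow$ on $S$, $\operatorname{Mult}(\twoheadrightarrow,\hookrightarrow)$ is the relation relating $x$ to $z$ iff there is $y\in S$ with $x\twoheadrightarrow y\hookrightarrow z$. A factorization system is a tuple $(S,\to,\twoheadrightarrow,\hookrightarrow)$ with $\to$ reflexive, $\operatorname{Fact}(\to)=(\twoheadrightarrow,\hookrightarrow)$ and $\operatorname{Mult}(\twoheadrightarrow,\hookrightarrow)=\to$; it is finite if $S$ is finite. It is two-acyclic if $x\twoheadrightarrow y\twoheadrightarrow x$ implies $x=y$, $x\hookrightarrow y\hookrightarrow x$ implies $x=y$, and $x\twoheadrightarrow y\hookrightarrow x$ implies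 $x=y$. Convention: $x\twoheadrightarrow y$ or $x\hookrightarrow y$ is read as "$x$ is greater than or equal to $y$"; thus $x$ is $\twoheadrightarrow$-minimal in $A\ni x$ if there is no $x'\in A\setminus\{x\}$ with $x\twoheadrightarrow x'$, and $\hookrightarrow$-maximal in $A$ if there is no $x'\in A\setminus\{x\}$ with $x'\hookrightarrow x$. For $y\in S$, $T(y)=\{x'\in S: y\twoheadrightarrow x'\}$ and $F(y)=\{x'\in S: x'\hookrightarrow y\}$. The relation $\rightsquigarrow$ on $S$: $x\rightsquigarrow y$ iff either $x$ is $\twoheadrightarrow$-minimal in $F(y)$ or $x$ is $\hookrightarrow$-maximal in $T(y)$. The relation $\rightsquigarrow$ always contains $x\rightsquigarrow x$; "acyclic" means having no directed cycles other than these loops. For a finite lattice $L$, $\operatorname{Ji}L$ (resp. $\operatorname{Mi}L$) is the set of elements $j$ covering exactly one element $j_*$ (resp. elements $m$ covered by exactly one element $m^*$). $\operatorname{Con}(L)$ is the lattice of congruences of $L$ under refinement (finer is smaller), which is distributive. For a cover $a\lessdot b$, $\operatorname{con}(a,b)$ is the finest congruence with $a\equiv b$. A finite lattice $L$ is congruence uniform if the maps $j\mapsto\operatorname{con}(j_*,j)$ from $\operatorname{Ji}L$ to $\operatorname{Ji}(\operatorname{Con}(L))$ and $m\mapsto\operatorname{con}(m,m^* )$ from $\operatorname{Mi}L$ to $\operatorname{Ji}(\operatorname{Con}(L))$ are both bijections. *)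

theory Defs
  imports "HOL-Algebra.Complete_Lattice"
begin

section \<open>Maximal orthogonal pairs\<close>

definition right_perp :: "'a set \<Rightarrow> 'a rel \<Rightarrow> 'a set \<Rightarrow> 'a set" where
  "right_perp S arr X = {y \<in> S. \<forall>x\<in>X. (x, y) \<notin> arr}"

definition left_perp :: "'a set \<Rightarrow> 'a rel \<Rightarrow> 'a set \<Rightarrow> 'a set" where
  "left_perp S arr X = {y \<in> S. \<forall>x\<in>X. (y, x) \<notin> arr}"

definition Pairs :: "'a set \<Rightarrow> 'a rel \<Rightarrow> ('a set \<times> 'a set) gorder" where
  "Pairs S arr =
     \<lparr> carrier = {(X, Y). X \<subseteq> S \<and> Y \<subseteq> S \<and> Y = right_perp S arr X \<and> X = left_perp S arr Y},
       eq = (=),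
       le = (\<lambda>P Q. fst P \<subseteq> fst Q) \<rparr>"


section \<open>Factorization systems\<close>

definition Fact :: "'a set \<Rightarrow> 'a rel \<Rightarrow> 'a rel \<times> 'a rel" where
  "Fact S arr =
     ({(x, y). x \<in> S \<and> y \<in> S \<and> (\<forall>z\<in>S. (y, z) \<in> arr \<longrightarrow> (x, z) \<in> arr)},
      {(x, y). x \<in> S \<and> y \<in> S \<and> (\<forall>z\<in>S. (z, x) \<in> arr \<longrightarrow> (z, y) \<in> arr)})"

definition Mult :: "'a rel \<Rightarrow> 'a rel \<Rightarrow> 'a rel" where
  "Mult onto into = onto O into"

text \<open>Here \<open>arr\<close>, \<open>onto\<close> and \<open>into\<close> are the relations usually drawn as a plain, a two-headed and
  a hooked arrow. In the library \<^const>\<open>refl_on\<close> does not bound the relation by \<open>S\<close>.\<close>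

definition factorization_system :: "'a set \<Rightarrow> 'a rel \<Rightarrow> 'a rel \<Rightarrow> 'a rel \<Rightarrow> bool" where
  "factorization_system S arr onto into \<longleftrightarrow>
     arr \<subseteq> S \<times> S \<and> refl_on S arr \<and>
     Fact S arr = (onto, into) \<and> Mult onto into = arr"

definition two_acyclic :: "'a rel \<Rightarrow> 'a rel \<Rightarrow> bool" where
  "two_acyclic onto into \<longleftrightarrow>
     (\<forall>x y. (x, y) \<in> onto \<and> (y, x) \<in> onto \<longrightarrow> x = y) \<and>
     (\<forall>x y. (x, y) \<in> into \<and> (y, x) \<in> into \<longrightarrow> x = y) \<and>
     (\<forall>x y. (x, y) \<in> onto \<and> (y, x) \<in> into \<longrightarrow> x = y)"

definition T_set :: "'a set \<Rightarrow> 'a rel \<Rightarrow> 'a \<Rightarrow> 'a set" where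
  "T_set S onto y = {x \<in> S. (y, x) \<in> onto}"

definition F_set :: "'a set \<Rightarrow> 'a rel \<Rightarrow> 'a \<Rightarrow> 'a set" where
  "F_set S into y = {x \<in> S. (x, y) \<in> into}"

text \<open>A pair \<open>(x, y)\<close> in the relation \<open>r\<close> is read as ``\<open>x\<close> is greater than or equal to \<open>y\<close>''.\<close>

definition minimal_in :: "'a rel \<Rightarrow> 'a set \<Rightarrow> 'a \<Rightarrow> bool" where
  "minimal_in r A x \<longleftrightarrow> x \<in> A \<and> \<not> (\<exists>x'\<in>A - {x}. (x, x') \<in> r)"

definition maximal_in :: "'a rel \<Rightarrow> 'a set \<Rightarrow> 'a \<Rightarrow> bool" where
  "maximal_in r A x \<longleftrightarrow> x \<in> A \<and> \<not> (\<exists>x'\<in>A - {x}. (x', x) \<in> r)"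

definition squig :: "'a set \<Rightarrow> 'a rel \<Rightarrow> 'a rel \<Rightarrow> 'a rel" where
  "squig S onto into =
     {(x, y). x \<in> S \<and> y \<in> S \<and>
        (minimal_in onto (F_set S into y) x \<or> maximal_in into (T_set S onto y) x)}"

definition acyclic_except_loops :: "'a rel \<Rightarrow> bool" where
  "acyclic_except_loops r \<longleftrightarrow> acyclic (r - Id)"


section \<open>Congruence uniform lattices\<close>

definition covered_by :: "('a, 'b) gorder_scheme \<Rightarrow> 'a \<Rightarrow> 'a \<Rightarrow> bool" where
  "covered_by L a b \<longleftrightarrow>
     a \<in> carrier L \<and> b \<in> carrier L \<and> a \<sqsubset>\<^bsub>L\<^esub> b \<and>
     \<not> (\<exists>c\<in>carrier L. a \<sqsubset>\<^bsub>L\<^esub> c \<and> c \<sqsubset>\<^bsub>L\<^esub> b)"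

definition Ji :: "('a, 'b) gorder_scheme \<Rightarrow> 'a set" where
  "Ji L = {j \<in> carrier L. \<exists>!a. covered_by L a j}"

definition Mi :: "('a, 'b) gorder_scheme \<Rightarrow> 'a set" where
  "Mi L = {m \<in> carrier L. \<exists>!b. covered_by L m b}"

definition lower_star :: "('a, 'b) gorder_scheme \<Rightarrow> 'a \<Rightarrow> 'a" where
  "lower_star L j = (THE a. covered_by L a j)"

definition upper_star :: "('a, 'b) gorder_scheme \<Rightarrow> 'a \<Rightarrow> 'a" where
  "upper_star L m = (THE b. covered_by L m b)"

definition lattice_congruence :: "('a, 'b) gorder_scheme \<Rightarrow> 'a rel \<Rightarrow> bool" where
  "lattice_congruence L \<theta> \<longleftrightarrow>
     equiv (carrier L) \<theta> \<and>
     (\<forall>a a' b b'. (a, a') \<in> \<theta> \<and> (b, b') \<in> \<theta> \<longrightarrow>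
        (a \<squnion>\<^bsub>L\<^esub> b, a' \<squnion>\<^bsub>L\<^esub> b') \<in> \<theta> \<and> (a \<sqinter>\<^bsub>L\<^esub> b, a' \<sqinter>\<^bsub>L\<^esub> b') \<in> \<theta>)"

definition Con :: "('a, 'b) gorder_scheme \<Rightarrow> 'a rel gorder" where
  "Con L = \<lparr> carrier = {\<theta>. lattice_congruence L \<theta>}, eq = (=), le = (\<subseteq>) \<rparr>"

definition con :: "('a, 'b) gorder_scheme \<Rightarrow> 'a \<Rightarrow> 'a \<Rightarrow> 'a rel" where
  "con L a b = (THE \<theta>. least (Con L) \<theta> {\<phi> \<in> carrier (Con L). (a, b) \<in> \<phi>})"

definition congruence_uniform :: "('a, 'b) gorder_scheme \<Rightarrow> bool" where
  "congruence_uniform L \<longleftrightarrow>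
     lattice L \<and> finite (carrier L) \<and>
     bij_betw (\<lambda>j. con L (lower_star L j) j) (Ji L) (Ji (Con L)) \<and>
     bij_betw (\<lambda>m. con L m (upper_star L m)) (Mi L) (Ji (Con L))"


section \<open>Well-definedness\<close>

lemma complete_lattice_Pairs: "complete_lattice (Pairs S arr)"
proof -
  interpret partial_order "Pairs S arr"
    by unfold_locales (auto simp: Pairs_def)
  have rl: "X \<subseteq> left_perp S arr (right_perp S arr X)" if "X \<subseteq> S" for X
    using that by (auto simp: left_perp_def right_perp_def)
  have lr: "Y \<subseteq> right_perp S arr (left_perp S arr Y)" if "Y \<subseteq> S" for Y
    using that by (auto simp: left_perp_def right_perp_def)
  have ranti: "right_perp S arr X' \<subseteq> right_perp S arr X" if "X \<subseteq> X'" for X X'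
    using that by (auto simp: right_perp_def)
  have lanti: "left_perp S arr X' \<subseteq> left_perp S arr X" if "X \<subseteq> X'" for X X'
    using that by (auto simp: left_perp_def)
  have lS: "left_perp S arr Y \<subseteq> S" and rS: "right_perp S arr Y \<subseteq> S" for Y
    by (auto simp: left_perp_def right_perp_def)
  have carr: "P \<in> carrier (Pairs S arr) \<longleftrightarrow>
      snd P = right_perp S arr (fst P) \<and> fst P = left_perp S arr (snd P)" for P
    using lS[of "snd P"] rS[of "fst P"] by (cases P) (simp add: Pairs_def, metis)
  have fstD: "left_perp S arr (snd P) = fst P" and sndD: "right_perp S arr (fst P) = snd P"
    if "P \<in> carrier (Pairs S arr)" for P
    using that carr by metis+
  have sub: "fst P \<subseteq> S" "snd P \<subseteq> S" if "P \<in> carrier (Pairs S arr)" for P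
    using that by (auto simp: Pairs_def)
  have le: "P \<sqsubseteq>\<^bsub>Pairs S arr\<^esub> Q \<longleftrightarrow> fst P \<subseteq> fst Q" for P Q
    by (simp add: Pairs_def)
  have le': "fst P \<subseteq> fst Q \<longleftrightarrow> snd Q \<subseteq> snd P"
    if "P \<in> carrier (Pairs S arr)" "Q \<in> carrier (Pairs S arr)" for P Q
    using ranti[of "fst P" "fst Q"] lanti[of "snd Q" "snd P"] that by (metis carr)
  show ?thesis
  proof
    fix A assume A: "A \<subseteq> carrier (Pairs S arr)"
    define Y where "Y = S \<inter> \<Inter>(snd ` A)"
    define s where "s = (left_perp S arr Y, right_perp S arr (left_perp S arr Y))"
    have YS: "Y \<subseteq> S" by (simp add: Y_def)
    have s: "s \<in> carrier (Pairs S arr)"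
      unfolding carr s_def using lanti[OF lr[OF YS]] rl[OF lS] by auto
    have 1: "s \<in> Upper (Pairs S arr) A"
    proof (rule Upper_memI)
      fix P assume "P \<in> A"
      then have "Y \<subseteq> snd P" "P \<in> carrier (Pairs S arr)" using A by (auto simp: Y_def)
      then show "P \<sqsubseteq>\<^bsub>Pairs S arr\<^esub> s"
        using lanti[of Y "snd P"] by (simp add: le s_def fstD)
    qed fact
    have 2: "s \<sqsubseteq>\<^bsub>Pairs S arr\<^esub> Q" if Q: "Q \<in> Upper (Pairs S arr) A" for Q
    proof -
      have Qc: "Q \<in> carrier (Pairs S arr)" using Q by (simp add: Upper_def)
      have "snd Q \<subseteq> snd P" if "P \<in> A" for P
      proof -
        have "P \<in> carrier (Pairs S arr)" using A that by blast
        moreover have "fst P \<subseteq> fst Q" using Upper_memD[OF Q that A] by (simp add: le)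
        ultimately show ?thesis using le' Qc by blast
      qed
      then have "snd Q \<subseteq> Y" using sub[OF Qc] by (auto simp: Y_def)
      then show ?thesis using lanti[of "snd Q" Y] Qc by (simp add: le s_def fstD)
    qed
    have "least (Pairs S arr) s (Upper (Pairs S arr) A)"
      using 1 2 by (simp add: least_def)
    then show "\<exists>s. least (Pairs S arr) s (Upper (Pairs S arr) A)" ..
  next
    fix A assume A: "A \<subseteq> carrier (Pairs S arr)"
    define X where "X = S \<inter> \<Inter>(fst ` A)"
    define i where "i = (left_perp S arr (right_perp S arr X), right_perp S arr X)"
    have XS: "X \<subseteq> S" by (simp add: X_def)
    have i: "i \<in> carrier (Pairs S arr)"
      unfolding carr i_def using ranti[OF rl[OF XS]] lr[OF rS] by auto
    have 1: "i \<in> Lower (Pairs S arr) A"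
    proof (rule Lower_memI)
      fix P assume "P \<in> A"
      then have P: "X \<subseteq> fst P" "P \<in> carrier (Pairs S arr)" using A by (auto simp: X_def)
      then have "snd P \<subseteq> snd i"
        using ranti[of X "fst P"] by (simp add: i_def sndD)
      then show "i \<sqsubseteq>\<^bsub>Pairs S arr\<^esub> P" using le'[OF i P(2)] by (simp add: le)
    qed fact
    have 2: "Q \<sqsubseteq>\<^bsub>Pairs S arr\<^esub> i" if Q: "Q \<in> Lower (Pairs S arr) A" for Q
    proof -
      have Qc: "Q \<in> carrier (Pairs S arr)" using Q by (simp add: Lower_def)
      have "fst Q \<subseteq> fst P" if "P \<in> A" for P
        using Lower_memD[OF Q that A] by (simp add: le)
      then have "fst Q \<subseteq> X" using sub[OF Qc] by (auto simp: X_def)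
      then show ?thesis using rl[OF XS] by (auto simp: le i_def)
    qed
    have "greatest (Pairs S arr) i (Lower (Pairs S arr) A)"
      using 1 2 by (simp add: greatest_def Lower_def)
    then show "\<exists>i. greatest (Pairs S arr) i (Lower (Pairs S arr) A)" ..
  qed
qed

lemma lattice_congruence_Inter:
  assumes "C \<noteq> {}" and C: "\<And>\<theta>. \<theta> \<in> C \<Longrightarrow> lattice_congruence L \<theta>"
  shows "lattice_congruence L (\<Inter>C)"
proof -
  have E: "\<theta> \<subseteq> carrier L \<times> carrier L" "refl_on (carrier L) \<theta>" "sym \<theta>" "trans \<theta>" if "\<theta> \<in> C" for \<theta>
    using C[OF that] by (auto simp: lattice_congruence_def equiv_def)
  have "equiv (carrier L) (\<Inter>C)"
  proof (rule equivI)
    show "\<Inter>C \<subseteq> carrier L \<times> carrier L" using E(1) \<open>C \<noteq> {}\<close> by blast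
    show "refl_on (carrier L) (\<Inter>C)" using E(2) by (simp add: refl_on_def)
    show "sym (\<Inter>C)" using E(3) unfolding sym_def by blast
    show "trans (\<Inter>C)" using E(4) unfolding trans_def by blast
  qed
  then show ?thesis using C unfolding lattice_congruence_def by simp
qed

lemma con_least:
  assumes "lattice L" "a \<in> carrier L" "b \<in> carrier L"
  shows "least (Con L) (con L a b) {\<phi> \<in> carrier (Con L). (a, b) \<in> \<phi>}"
proof -
  interpret lattice L by fact
  let ?C = "{\<phi> \<in> carrier (Con L). (a, b) \<in> \<phi>}"
  have "carrier L \<times> carrier L \<in> ?C"
    using assms by (auto simp: Con_def lattice_congruence_def equiv_def refl_on_def sym_def trans_def)
  then have "lattice_congruence L (\<Inter>?C)"
    by (intro lattice_congruence_Inter) (auto simp: Con_def)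
  then have 1: "least (Con L) (\<Inter>?C) ?C"
    by (auto simp: least_def Con_def)
  have 2: "\<theta> = \<Inter>?C" if "least (Con L) \<theta> ?C" for \<theta>
  proof (rule antisym)
    show "\<theta> \<subseteq> \<Inter>?C" using that by (auto simp: least_def Con_def)
    show "\<Inter>?C \<subseteq> \<theta>" using that by (auto simp: least_def)
  qed
  show ?thesis
    unfolding con_def using 1 2 by (rule theI)
qed

lemma squig_refl:
  assumes "factorization_system S arr onto into" "two_acyclic onto into" "x \<in> S"
  shows "(x, x) \<in> squig S onto into"
proof -
  have into: "into = {(x, y). x \<in> S \<and> y \<in> S \<and> (\<forall>z\<in>S. (z, x) \<in> arr \<longrightarrow> (z, y) \<in> arr)}"
    using assms(1) by (simp add: factorization_system_def Fact_def)
  have "(x, x) \<in> into" unfolding into using assms(3) by simp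
  then have "minimal_in onto (F_set S into x) x"
    using assms(2,3) unfolding minimal_in_def F_set_def two_acyclic_def by blast
  then show ?thesis using assms(3) by (simp add: squig_def)
qed

end

theory Submission
  imports Defs
begin

text \<open>Every \<open>x \<in> S\<close> yields a join-irreducible pair \<open>j\<^sub>x\<close> with first component \<open>T(x)\<close> and a
  meet-irreducible pair \<open>m\<^sub>x\<close> with second component \<open>F(x)\<close>. Two-acyclicity says that
  \<open>j\<^sub>x \<sqinter> m\<^sub>x\<close> is the lower cover of \<open>j\<^sub>x\<close> and \<open>j\<^sub>x \<squnion> m\<^sub>x\<close> is the upper cover of \<open>m\<^sub>x\<close>, so a
  congruence collapses the one cover iff it collapses the other. A congruence is determined by the
  set of those \<open>x\<close> whose covers it collapses, and the sets that arise are exactly those closed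
  under \<open>\<leadsto>\<close>. Hence the congruence generated by \<open>x\<close> corresponds to the set of all elements reachable
  from \<open>x\<close>, and \<open>x\<close> is determined by its congruence iff \<open>\<leadsto>\<close> has no proper cycles.\<close>

section \<open>Unique covers in finite partial orders\<close>

text \<open>Induction on the number of elements strictly between \<open>a\<close> and
  \<open>b\<close>: passing from \<open>a\<close> to an intermediate \<open>c\<close> removes at
  least \<open>c\<close> itself from the interval.\<close>

lemma (in partial_order) ex_covered_by_above:
  assumes "finite (carrier L)" "a \<in> carrier L" "b \<in> carrier L" "a \<sqsubset> b"
  shows "\<exists>c. covered_by L c b \<and> a \<sqsubseteq> c"
  using assms(2,4)
proof (induction "card {x \<in> carrier L. a \<sqsubset> x \<and> x \<sqsubset> b}" arbitrary: a rule: less_induct)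
  case less
  show ?case
  proof (cases "covered_by L a b")
    case True
    then show ?thesis using less.prems by auto
  next
    case False
    then obtain c where c: "c \<in> carrier L" "a \<sqsubset> c" "c \<sqsubset> b"
      using less.prems assms(3) by (auto simp: covered_by_def)
    have "{x \<in> carrier L. c \<sqsubset> x \<and> x \<sqsubset> b} \<subset> {x \<in> carrier L. a \<sqsubset> x \<and> x \<sqsubset> b}"
      using c less.prems assms(3) lless_trans[of a c] by (intro psubsetI) (auto simp: lless_eq)
    then have "card {x \<in> carrier L. c \<sqsubset> x \<and> x \<sqsubset> b} < card {x \<in> carrier L. a \<sqsubset> x \<and> x \<sqsubset> b}"
      using assms(1) by (intro psubset_card_mono) auto
    then obtain d where "covered_by L d b" "c \<sqsubseteq> d"
      using less.hyps c by blast
    then show ?thesis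
      using c less.prems by (meson covered_by_def le_trans lless_eq)
  qed
qed

lemma (in partial_order) covered_by_iff_eq:
  assumes "p \<in> carrier L" "q \<in> carrier L" "q \<sqsubset> p"
    and "\<And>r. r \<in> carrier L \<Longrightarrow> r \<sqsubset> p \<Longrightarrow> r \<sqsubseteq> q"
  shows "covered_by L a p \<longleftrightarrow> a = q"
proof
  assume "covered_by L a p"
  then show "a = q" using assms unfolding covered_by_def lless_eq by blast
next
  assume "a = q"
  then show "covered_by L a p"
    using assms unfolding covered_by_def lless_eq by (metis le_antisym)
qed

text \<open>By finiteness every element strictly below \<open>p\<close> lies under some lower cover,
  so a unique lower cover is the greatest element strictly below \<open>p\<close>. This form is
  easier to use than counting covers.\<close>

lemma (in partial_order) ex1_covered_by_iff:
  assumes "finite (carrier L)" "p \<in> carrier L"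
  shows "(\<exists>!a. covered_by L a p) \<longleftrightarrow>
    (\<exists>q\<in>carrier L. q \<sqsubset> p \<and> (\<forall>r\<in>carrier L. r \<sqsubset> p \<longrightarrow> r \<sqsubseteq> q))"
proof
  assume u: "\<exists>!a. covered_by L a p"
  then obtain q where q: "covered_by L q p" by blast
  moreover have "r \<sqsubseteq> q" if "r \<in> carrier L" "r \<sqsubset> p" for r
    using ex_covered_by_above[OF assms(1) that(1) assms(2) that(2)] q u by blast
  ultimately show "\<exists>q\<in>carrier L. q \<sqsubset> p \<and> (\<forall>r\<in>carrier L. r \<sqsubset> p \<longrightarrow> r \<sqsubseteq> q)"
    by (auto simp: covered_by_def)
next
  assume "\<exists>q\<in>carrier L. q \<sqsubset> p \<and> (\<forall>r\<in>carrier L. r \<sqsubset> p \<longrightarrow> r \<sqsubseteq> q)"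
  then show "\<exists>!a. covered_by L a p"
    using covered_by_iff_eq[OF assms(2)] by metis
qed

text \<open>Transfers the results on lower covers to upper covers through the dual order.\<close>

lemma (in partial_order) covered_by_inv_gorder:
  "covered_by (inv_gorder L) a b \<longleftrightarrow> covered_by L b a"
  by (auto simp: covered_by_def lless_def eq_is_equal)


section \<open>Irreducible pairs\<close>

locale two_acyclic_factorization_system =
  fixes S :: "'a set" and arr onto into :: "'a rel"
  assumes fin: "finite S"
    and fs: "factorization_system S arr onto into"
    and ta: "two_acyclic onto into"
begin

abbreviation L :: "('a set \<times> 'a set) gorder" where "L \<equiv> Pairs S arr"

sublocale complete_lattice L by (rule complete_lattice_Pairs)

section \<open>Elementary properties of the three relations\<close>

lemma arr_in_S: "(x, y) \<in> arr \<Longrightarrow> x \<in> S \<and> y \<in> S"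
  using fs by (auto simp: factorization_system_def)

lemma arr_refl: "x \<in> S \<Longrightarrow> (x, x) \<in> arr"
  using fs by (auto simp: factorization_system_def refl_on_def)

lemma onto_iff: "(x, y) \<in> onto \<longleftrightarrow> x \<in> S \<and> y \<in> S \<and> (\<forall>z\<in>S. (y, z) \<in> arr \<longrightarrow> (x, z) \<in> arr)"
  using fs by (auto simp: factorization_system_def Fact_def)

lemma into_iff: "(x, y) \<in> into \<longleftrightarrow> x \<in> S \<and> y \<in> S \<and> (\<forall>z\<in>S. (z, x) \<in> arr \<longrightarrow> (z, y) \<in> arr)"
  using fs by (auto simp: factorization_system_def Fact_def)

lemma arr_iff: "(x, z) \<in> arr \<longleftrightarrow> (\<exists>y. (x, y) \<in> onto \<and> (y, z) \<in> into)"
  using fs by (auto simp: factorization_system_def Mult_def)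

lemma onto_trans: "(x, y) \<in> onto \<Longrightarrow> (y, z) \<in> onto \<Longrightarrow> (x, z) \<in> onto"
  by (simp add: onto_iff)

lemma into_trans: "(x, y) \<in> into \<Longrightarrow> (y, z) \<in> into \<Longrightarrow> (x, z) \<in> into"
  by (simp add: into_iff)

lemma onto_refl: "x \<in> S \<Longrightarrow> (x, x) \<in> onto"
  by (simp add: onto_iff)

lemma into_refl: "x \<in> S \<Longrightarrow> (x, x) \<in> into"
  by (simp add: into_iff)

lemma onto_antisym: "(x, y) \<in> onto \<Longrightarrow> (y, x) \<in> onto \<Longrightarrow> x = y"
  using ta by (auto simp: two_acyclic_def)

lemma into_antisym: "(x, y) \<in> into \<Longrightarrow> (y, x) \<in> into \<Longrightarrow> x = y"
  using ta by (auto simp: two_acyclic_def)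

lemma onto_into_eq: "(x, y) \<in> onto \<Longrightarrow> (y, x) \<in> into \<Longrightarrow> x = y"
  using ta by (auto simp: two_acyclic_def)

lemma onto_arr_trans: "(x, y) \<in> onto \<Longrightarrow> (y, z) \<in> arr \<Longrightarrow> (x, z) \<in> arr"
  using arr_in_S by (auto simp: onto_iff)

lemma arr_into_trans: "(x, y) \<in> arr \<Longrightarrow> (y, z) \<in> into \<Longrightarrow> (x, z) \<in> arr"
  using arr_in_S by (auto simp: into_iff)

text \<open>Strengthens the mixed acyclicity condition from \<open>into\<close> to
  \<open>arr\<close>. Factoring the arrow from \<open>y\<close> to \<open>x\<close> through
  \<open>z\<close> gives \<open>(x, z) \<in> onto\<close> and \<open>(z, x) \<in> into\<close>, so
  \<open>z = x\<close>, and \<open>x\<close> and \<open>y\<close> are then related by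
  \<open>onto\<close> in both directions.\<close>

lemma onto_arr_eq:
  assumes "(x, y) \<in> onto" "(y, x) \<in> arr"
  shows "x = y"
proof -
  obtain z where "(y, z) \<in> onto" "(z, x) \<in> into" using assms(2) arr_iff by blast
  then show ?thesis using assms(1) onto_trans onto_into_eq onto_antisym by metis
qed

lemma into_arr_eq:
  assumes "(x, y) \<in> into" "(y, x) \<in> arr"
  shows "x = y"
proof -
  obtain z where "(y, z) \<in> onto" "(z, x) \<in> into" using assms(2) arr_iff by blast
  then show ?thesis using assms(1) into_trans onto_into_eq into_antisym by metis
qed

section \<open>The order on maximal orthogonal pairs\<close>

lemma carrier_iff:
  "P \<in> carrier L \<longleftrightarrow> snd P = right_perp S arr (fst P) \<and> fst P = left_perp S arr (snd P)"
  by (cases P) (auto simp: Pairs_def right_perp_def left_perp_def)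

lemma mem_fst_iff:
  assumes "P \<in> carrier L"
  shows "x \<in> fst P \<longleftrightarrow> x \<in> S \<and> (\<forall>y\<in>snd P. (x, y) \<notin> arr)"
proof -
  have "fst P = left_perp S arr (snd P)" using assms carrier_iff by blast
  then have "x \<in> fst P \<longleftrightarrow> x \<in> left_perp S arr (snd P)" by (rule arg_cong)
  then show ?thesis by (simp add: left_perp_def)
qed

lemma mem_snd_iff:
  assumes "P \<in> carrier L"
  shows "y \<in> snd P \<longleftrightarrow> y \<in> S \<and> (\<forall>x\<in>fst P. (x, y) \<notin> arr)"
proof -
  have "snd P = right_perp S arr (fst P)" using assms carrier_iff by blast
  then have "y \<in> snd P \<longleftrightarrow> y \<in> right_perp S arr (fst P)" by (rule arg_cong)
  then show ?thesis by (simp add: right_perp_def)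
qed

lemma le_iff_fst: "P \<sqsubseteq>\<^bsub>L\<^esub> Q \<longleftrightarrow> fst P \<subseteq> fst Q"
  by (simp add: Pairs_def)

lemma le_iff_snd:
  assumes "P \<in> carrier L" "Q \<in> carrier L"
  shows "P \<sqsubseteq>\<^bsub>L\<^esub> Q \<longleftrightarrow> snd Q \<subseteq> snd P"
proof -
  have "left_perp S arr (snd P) \<subseteq> left_perp S arr (snd Q)" if "snd Q \<subseteq> snd P"
    using that by (auto simp: left_perp_def)
  moreover have "right_perp S arr (fst Q) \<subseteq> right_perp S arr (fst P)" if "fst P \<subseteq> fst Q"
    using that by (auto simp: right_perp_def)
  ultimately show ?thesis using assms unfolding le_iff_fst carrier_iff by metis
qed

lemma finite_carrier: "finite (carrier L)"
proof (rule finite_subset)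
  show "carrier L \<subseteq> Pow S \<times> Pow S" by (auto simp: Pairs_def)
qed (use fin in simp)

lemma fst_subset: "P \<in> carrier L \<Longrightarrow> fst P \<subseteq> S"
  by (auto simp: Pairs_def)

lemma fst_onto_closed:
  assumes "P \<in> carrier L" "x \<in> fst P" "(x, y) \<in> onto"
  shows "y \<in> fst P"
  using assms(2,3) onto_arr_trans[OF assms(3)] onto_iff[of x y]
  unfolding mem_fst_iff[OF assms(1)] by blast

lemma snd_into_closed:
  assumes "P \<in> carrier L" "y \<in> snd P" "(x, y) \<in> into"
  shows "x \<in> snd P"
  using assms(2,3) arr_into_trans[OF _ assms(3)] into_iff[of x y]
  unfolding mem_snd_iff[OF assms(1)] by blast

lemma pair_eq_iff_fst: "P \<in> carrier L \<Longrightarrow> Q \<in> carrier L \<Longrightarrow> P = Q \<longleftrightarrow> fst P = fst Q"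
  by (metis carrier_iff prod_eqI)

lemma pair_eq_iff_snd: "P \<in> carrier L \<Longrightarrow> Q \<in> carrier L \<Longrightarrow> P = Q \<longleftrightarrow> snd P = snd Q"
  by (metis carrier_iff prod_eqI)

lemma left_perp_carrier:
  "Y \<subseteq> S \<Longrightarrow> (left_perp S arr Y, right_perp S arr (left_perp S arr Y)) \<in> carrier L"
  by (auto simp: carrier_iff left_perp_def right_perp_def)

lemma right_perp_carrier:
  "X \<subseteq> S \<Longrightarrow> (left_perp S arr (right_perp S arr X), right_perp S arr X) \<in> carrier L"
  by (auto simp: carrier_iff left_perp_def right_perp_def)

section \<open>Meets and joins of pairs\<close>

lemma ex_pair_fst_Int:
  assumes "P \<in> carrier L" "Q \<in> carrier L"
  shows "\<exists>R\<in>carrier L. fst R = fst P \<inter> fst Q"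
proof
  show "(left_perp S arr (snd P \<union> snd Q), right_perp S arr (left_perp S arr (snd P \<union> snd Q))) \<in> carrier L"
    by (rule left_perp_carrier) (use assms mem_snd_iff in blast)
qed (use assms in \<open>auto simp: left_perp_def mem_fst_iff\<close>)

lemma ex_pair_snd_Int:
  assumes "P \<in> carrier L" "Q \<in> carrier L"
  shows "\<exists>R\<in>carrier L. snd R = snd P \<inter> snd Q"
proof
  show "(left_perp S arr (right_perp S arr (fst P \<union> fst Q)), right_perp S arr (fst P \<union> fst Q)) \<in> carrier L"
    by (rule right_perp_carrier) (use assms mem_fst_iff in blast)
qed (use assms in \<open>auto simp: right_perp_def mem_snd_iff\<close>)

text \<open>\<open>left_perp\<close> turns unions into intersections, so first components are closed
  under intersection. Only the second component of a join is equally explicit, hence meets are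
  computed on the left and joins on the right throughout.\<close>

lemma fst_meet:
  assumes "P \<in> carrier L" "Q \<in> carrier L"
  shows "fst (P \<sqinter>\<^bsub>L\<^esub> Q) = fst P \<inter> fst Q"
proof -
  obtain R where R: "R \<in> carrier L" "fst R = fst P \<inter> fst Q"
    using ex_pair_fst_Int[OF assms] by blast
  then have "R \<sqsubseteq>\<^bsub>L\<^esub> P \<sqinter>\<^bsub>L\<^esub> Q"
    using assms by (intro meet_le) (auto simp: le_iff_fst)
  then show ?thesis
    using R meet_left[OF assms] meet_right[OF assms] unfolding le_iff_fst by auto
qed

lemma snd_join:
  assumes "P \<in> carrier L" "Q \<in> carrier L"
  shows "snd (P \<squnion>\<^bsub>L\<^esub> Q) = snd P \<inter> snd Q"
proof -
  obtain R where R: "R \<in> carrier L" "snd R = snd P \<inter> snd Q"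
    using ex_pair_snd_Int[OF assms] by blast
  then have "P \<squnion>\<^bsub>L\<^esub> Q \<sqsubseteq>\<^bsub>L\<^esub> R"
    using assms by (intro join_le) (auto simp: le_iff_snd)
  then show ?thesis
    using R join_left[OF assms] join_right[OF assms] join_closed[OF assms] assms
    by (auto simp: le_iff_snd)
qed

section \<open>Join- and meet-irreducible pairs\<close>

definition ji :: "'a \<Rightarrow> 'a set \<times> 'a set" where
  "ji x = (T_set S onto x, {z \<in> S. (x, z) \<notin> arr})"

definition mi :: "'a \<Rightarrow> 'a set \<times> 'a set" where
  "mi x = ({z \<in> S. (z, x) \<notin> arr}, F_set S into x)"

text \<open>Expressing both covers through \<open>ji x\<close> and \<open>mi x\<close> makes the
  intervals from \<open>ji_star x\<close> to \<open>ji x\<close> and from \<open>mi x\<close> to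
  \<open>mi_star x\<close> perspective; \<open>collapsed_iff_mi\<close> rests on this.\<close>

abbreviation ji_star :: "'a \<Rightarrow> 'a set \<times> 'a set" where
  "ji_star x \<equiv> ji x \<sqinter>\<^bsub>L\<^esub> mi x"

abbreviation mi_star :: "'a \<Rightarrow> 'a set \<times> 'a set" where
  "mi_star x \<equiv> ji x \<squnion>\<^bsub>L\<^esub> mi x"

text \<open>By the definition of \<open>Fact\<close>, \<open>(x, y) \<in> onto\<close> says that the
  right orthogonal of \<open>x\<close> is contained in that of \<open>y\<close>. So
  \<open>T_set S onto x\<close> is the double orthogonal of \<open>{x}\<close>.\<close>

lemma ji_carrier: "x \<in> S \<Longrightarrow> ji x \<in> carrier L"
  using arr_in_S onto_refl
  by (auto simp: carrier_iff ji_def T_set_def right_perp_def left_perp_def onto_iff)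

lemma mi_carrier: "x \<in> S \<Longrightarrow> mi x \<in> carrier L"
  using arr_in_S into_refl
  by (auto simp: carrier_iff mi_def F_set_def right_perp_def left_perp_def into_iff)

lemma ji_star_carrier: "x \<in> S \<Longrightarrow> ji_star x \<in> carrier L"
  by (simp add: ji_carrier mi_carrier)

lemma mi_star_carrier: "x \<in> S \<Longrightarrow> mi_star x \<in> carrier L"
  by (simp add: ji_carrier mi_carrier)

lemmas irreducible_carrier = ji_carrier mi_carrier ji_star_carrier mi_star_carrier

lemma fst_ji: "fst (ji x) = T_set S onto x"
  by (simp add: ji_def)

lemma snd_mi: "snd (mi x) = F_set S into x"
  by (simp add: mi_def)

lemma snd_ji: "snd (ji x) = {z \<in> S. (x, z) \<notin> arr}"
  by (simp add: ji_def)

lemma fst_mi: "fst (mi x) = {z \<in> S. (z, x) \<notin> arr}"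
  by (simp add: mi_def)

text \<open>The meet with \<open>mi x\<close> discards the elements of \<open>T_set S onto x\<close>
  with an arrow to \<open>x\<close>; by \<open>onto_arr_eq\<close> only \<open>x\<close> is such an
  element.\<close>

lemma fst_ji_star:
  assumes "x \<in> S"
  shows "fst (ji_star x) = T_set S onto x - {x}"
  using assms onto_arr_eq arr_refl
  by (auto simp: fst_meet irreducible_carrier fst_ji fst_mi T_set_def)

lemma snd_mi_star:
  assumes "x \<in> S"
  shows "snd (mi_star x) = F_set S into x - {x}"
  using assms into_arr_eq arr_refl
  by (auto simp: snd_join irreducible_carrier snd_ji snd_mi F_set_def)

text \<open>First components are closed under \<open>onto\<close>, so \<open>ji x\<close> is the
  least pair whose first component contains \<open>x\<close>.\<close>

lemma ji_le_iff:
  assumes "x \<in> S" "P \<in> carrier L"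
  shows "ji x \<sqsubseteq>\<^bsub>L\<^esub> P \<longleftrightarrow> x \<in> fst P"
  using assms fst_onto_closed[of P x] onto_refl by (auto simp: le_iff_fst fst_ji T_set_def)

lemma le_mi_iff:
  assumes "x \<in> S" "P \<in> carrier L"
  shows "P \<sqsubseteq>\<^bsub>L\<^esub> mi x \<longleftrightarrow> x \<in> snd P"
  using assms snd_into_closed[of P x] into_refl by (auto simp: le_iff_snd irreducible_carrier snd_mi F_set_def)

lemma inj_on_ji: "inj_on ji S"
proof (rule inj_onI)
  fix x y assume "x \<in> S" "y \<in> S" "ji x = ji y"
  then have "T_set S onto x = T_set S onto y" by (metis fst_ji)
  then show "x = y" using \<open>x \<in> S\<close> \<open>y \<in> S\<close> onto_refl onto_antisym unfolding T_set_def by blast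
qed

lemma inj_on_mi: "inj_on mi S"
proof (rule inj_onI)
  fix x y assume "x \<in> S" "y \<in> S" "mi x = mi y"
  then have "F_set S into x = F_set S into y" by (metis snd_mi)
  then show "x = y" using \<open>x \<in> S\<close> \<open>y \<in> S\<close> into_refl into_antisym unfolding F_set_def by blast
qed

lemma ji_star_less: "x \<in> S \<Longrightarrow> ji_star x \<sqsubset>\<^bsub>L\<^esub> ji x"
  using onto_refl
  by (auto simp: lless_eq le_iff_fst fst_ji_star fst_ji pair_eq_iff_fst irreducible_carrier T_set_def)

text \<open>If the first component of \<open>P\<close> contained \<open>x\<close>, then
  \<open>P\<close> would lie above \<open>ji x\<close>.\<close>

lemma le_ji_star:
  assumes "x \<in> S" "P \<in> carrier L" "P \<sqsubset>\<^bsub>L\<^esub> ji x"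
  shows "P \<sqsubseteq>\<^bsub>L\<^esub> ji_star x"
proof -
  have "x \<notin> fst P"
    using assms ji_le_iff[OF assms(1,2)] le_antisym ji_carrier by (auto simp: lless_eq)
  then show ?thesis using assms by (auto simp: lless_eq le_iff_fst fst_ji_star fst_ji)
qed

lemma mi_star_greater: "x \<in> S \<Longrightarrow> mi x \<sqsubset>\<^bsub>L\<^esub> mi_star x"
  using into_refl
  by (auto simp: lless_eq le_iff_snd snd_mi_star snd_mi pair_eq_iff_snd irreducible_carrier F_set_def)

lemma mi_star_le:
  assumes "x \<in> S" "P \<in> carrier L" "mi x \<sqsubset>\<^bsub>L\<^esub> P"
  shows "mi_star x \<sqsubseteq>\<^bsub>L\<^esub> P"
proof -
  have "x \<notin> snd P"
    using assms le_mi_iff[OF assms(1,2)] le_antisym mi_carrier by (auto simp: lless_eq)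
  then show ?thesis
    using assms by (auto simp: lless_eq le_iff_snd snd_mi_star snd_mi irreducible_carrier)
qed

lemma covered_by_ji_iff:
  assumes "x \<in> S"
  shows "covered_by L P (ji x) \<longleftrightarrow> P = ji_star x"
  using assms ji_star_less le_ji_star irreducible_carrier by (intro covered_by_iff_eq) auto

lemma lless_inv_gorder: "P \<sqsubset>\<^bsub>inv_gorder L\<^esub> Q \<longleftrightarrow> Q \<sqsubset>\<^bsub>L\<^esub> P"
  by (auto simp: lless_def eq_is_equal)

lemma covered_by_mi_iff:
  assumes "x \<in> S"
  shows "covered_by L (mi x) P \<longleftrightarrow> P = mi_star x"
proof -
  interpret D: partial_order "inv_gorder L" by (rule dual_order)
  show ?thesis
    unfolding covered_by_inv_gorder[symmetric]
    using assms mi_star_greater mi_star_le irreducible_carrier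
    by (intro D.covered_by_iff_eq) (auto simp: lless_inv_gorder)
qed

text \<open>If \<open>Q\<close> is the unique lower cover of \<open>P\<close>, any \<open>x\<close>
  in \<open>fst P - fst Q\<close> gives a pair \<open>ji x\<close> below \<open>P\<close> but not
  below \<open>Q\<close>; it cannot lie strictly below \<open>P\<close>.\<close>

lemma Ji_eq: "Ji L = ji ` S"
proof (intro equalityI subsetI)
  fix P assume "P \<in> Ji L"
  then have P: "P \<in> carrier L" "\<exists>!a. covered_by L a P" by (auto simp: Ji_def)
  then obtain Q where Q: "Q \<in> carrier L" "Q \<sqsubset>\<^bsub>L\<^esub> P"
    and below: "\<And>R. R \<in> carrier L \<Longrightarrow> R \<sqsubset>\<^bsub>L\<^esub> P \<Longrightarrow> R \<sqsubseteq>\<^bsub>L\<^esub> Q"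
    using ex1_covered_by_iff[OF finite_carrier P(1)] by blast
  have "\<not> fst P \<subseteq> fst Q"
    using P(1) Q le_antisym le_iff_fst unfolding lless_eq by blast
  then obtain x where x: "x \<in> fst P" "x \<notin> fst Q" by blast
  then have xS: "x \<in> S" using fst_subset P(1) by blast
  have "ji x \<sqsubseteq>\<^bsub>L\<^esub> P" "\<not> ji x \<sqsubseteq>\<^bsub>L\<^esub> Q" using ji_le_iff xS x P(1) Q(1) by auto
  then have "ji x = P" using below[OF ji_carrier[OF xS]] by (auto simp: lless_eq)
  then show "P \<in> ji ` S" using xS by blast
next
  fix P assume "P \<in> ji ` S"
  then obtain x where "x \<in> S" "P = ji x" by blast
  then show "P \<in> Ji L"
    by (simp add: Ji_def covered_by_ji_iff ji_carrier)
qed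

lemma lower_star_ji: "x \<in> S \<Longrightarrow> lower_star L (ji x) = ji_star x"
  by (simp add: lower_star_def covered_by_ji_iff)

text \<open>The argument for \<open>Ji_eq\<close> in the dual order, with second components in place
  of first ones.\<close>

lemma Mi_eq: "Mi L = mi ` S"
proof (intro equalityI subsetI)
  interpret D: partial_order "inv_gorder L" by (rule dual_order)
  have fin: "finite (carrier (inv_gorder L))" using finite_carrier by simp
  fix P assume "P \<in> Mi L"
  then have P: "P \<in> carrier L" "\<exists>!a. covered_by (inv_gorder L) a P"
    by (auto simp: Mi_def covered_by_inv_gorder)
  then obtain Q where Q: "Q \<in> carrier L" "P \<sqsubset>\<^bsub>L\<^esub> Q"
    and above: "\<And>R. R \<in> carrier L \<Longrightarrow> P \<sqsubset>\<^bsub>L\<^esub> R \<Longrightarrow> Q \<sqsubseteq>\<^bsub>L\<^esub> R"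
    using D.ex1_covered_by_iff[OF fin] by (auto simp: lless_inv_gorder)
  have "\<not> snd P \<subseteq> snd Q"
    using P(1) Q le_antisym le_iff_snd unfolding lless_eq by blast
  then obtain x where x: "x \<in> snd P" "x \<notin> snd Q" by blast
  then have xS: "x \<in> S" using P(1) mem_snd_iff by blast
  have "P \<sqsubseteq>\<^bsub>L\<^esub> mi x" "\<not> Q \<sqsubseteq>\<^bsub>L\<^esub> mi x" using le_mi_iff xS x P(1) Q(1) by auto
  then have "mi x = P" using above[OF mi_carrier[OF xS]] by (auto simp: lless_eq)
  then show "P \<in> mi ` S" using xS by blast
next
  fix P assume "P \<in> mi ` S"
  then obtain x where x: "x \<in> S" "P = mi x" by blast
  then have "\<exists>!b. covered_by L P b"
    by (intro ex1I[of _ "mi_star x"]) (simp_all add: covered_by_mi_iff)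
  then show "P \<in> Mi L" using x mi_carrier by (simp add: Mi_def)
qed

lemma upper_star_mi: "x \<in> S \<Longrightarrow> upper_star L (mi x) = mi_star x"
  unfolding upper_star_def by (rule the_equality) (simp_all add: covered_by_mi_iff)


section \<open>Congruences\<close>

text \<open>The code of a congruence as a subset of \<open>S\<close>;
  \<open>congruence_subset_iff\<close> shows that it loses no information.\<close>

definition collapsed :: "('a set \<times> 'a set) rel \<Rightarrow> 'a set" where
  "collapsed \<theta> = {x \<in> S. (ji_star x, ji x) \<in> \<theta>}"

lemma congruence_meet:
  "lattice_congruence L \<theta> \<Longrightarrow> (P, Q) \<in> \<theta> \<Longrightarrow> R \<in> carrier L \<Longrightarrow> (P \<sqinter>\<^bsub>L\<^esub> R, Q \<sqinter>\<^bsub>L\<^esub> R) \<in> \<theta>"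
  unfolding lattice_congruence_def equiv_def refl_on_def by blast

lemma congruence_join:
  "lattice_congruence L \<theta> \<Longrightarrow> (P, Q) \<in> \<theta> \<Longrightarrow> R \<in> carrier L \<Longrightarrow> (P \<squnion>\<^bsub>L\<^esub> R, Q \<squnion>\<^bsub>L\<^esub> R) \<in> \<theta>"
  unfolding lattice_congruence_def equiv_def refl_on_def by blast

lemma congruence_sym: "lattice_congruence L \<theta> \<Longrightarrow> (P, Q) \<in> \<theta> \<Longrightarrow> (Q, P) \<in> \<theta>"
  unfolding lattice_congruence_def by (meson equivE symD)

lemma congruence_trans: "lattice_congruence L \<theta> \<Longrightarrow> (P, Q) \<in> \<theta> \<Longrightarrow> (Q, R) \<in> \<theta> \<Longrightarrow> (P, R) \<in> \<theta>"
  unfolding lattice_congruence_def by (meson equivE transD)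

lemma congruence_refl: "lattice_congruence L \<theta> \<Longrightarrow> P \<in> carrier L \<Longrightarrow> (P, P) \<in> \<theta>"
  unfolding lattice_congruence_def by (meson equivE refl_onD)

lemma congruence_carrier:
  "lattice_congruence L \<theta> \<Longrightarrow> (P, Q) \<in> \<theta> \<Longrightarrow> P \<in> carrier L \<and> Q \<in> carrier L"
  unfolding lattice_congruence_def equiv_def by blast

lemma meet_eq: "P \<in> carrier L \<Longrightarrow> Q \<in> carrier L \<Longrightarrow> P \<sqsubseteq>\<^bsub>L\<^esub> Q \<Longrightarrow> P \<sqinter>\<^bsub>L\<^esub> Q = P \<and> Q \<sqinter>\<^bsub>L\<^esub> P = P"
  by (auto simp: pair_eq_iff_fst fst_meet le_iff_fst)

lemma join_eq: "P \<in> carrier L \<Longrightarrow> Q \<in> carrier L \<Longrightarrow> P \<sqsubseteq>\<^bsub>L\<^esub> Q \<Longrightarrow> P \<squnion>\<^bsub>L\<^esub> Q = Q \<and> Q \<squnion>\<^bsub>L\<^esub> P = Q"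
  by (auto simp: pair_eq_iff_snd snd_join le_iff_snd)

text \<open>Meeting the pair \<open>(P, R)\<close> with \<open>Q\<close> gives the first claim,
  joining it with \<open>Q\<close> the second.\<close>

lemma congruence_convex:
  assumes "lattice_congruence L \<theta>" "(P, R) \<in> \<theta>" "Q \<in> carrier L" "P \<sqsubseteq>\<^bsub>L\<^esub> Q" "Q \<sqsubseteq>\<^bsub>L\<^esub> R"
  shows "(P, Q) \<in> \<theta>" "(Q, R) \<in> \<theta>"
proof -
  have c: "P \<in> carrier L" "R \<in> carrier L" using congruence_carrier assms(1,2) by blast+
  show "(P, Q) \<in> \<theta>"
    using congruence_meet[OF assms(1-3)] meet_eq[OF c(1) assms(3,4)] meet_eq[OF assms(3) c(2) assms(5)]
    by simp
  show "(Q, R) \<in> \<theta>"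
    using congruence_join[OF assms(1-3)] join_eq[OF c(1) assms(3,4)] join_eq[OF assms(3) c(2) assms(5)]
    by simp
qed

text \<open>Joining with \<open>mi x\<close> carries the lower interval onto the upper one, and
  meeting with \<open>ji x\<close> carries it back.\<close>

lemma collapsed_iff_mi:
  assumes "lattice_congruence L \<theta>" "x \<in> S"
  shows "x \<in> collapsed \<theta> \<longleftrightarrow> (mi x, mi_star x) \<in> \<theta>"
proof -
  note c = irreducible_carrier[OF assms(2)]
  have "ji_star x \<squnion>\<^bsub>L\<^esub> mi x = mi x" "mi_star x \<sqinter>\<^bsub>L\<^esub> ji x = ji x" "mi x \<sqinter>\<^bsub>L\<^esub> ji x = ji_star x"
    using join_eq[OF c(3,2) meet_right[OF c(1,2)]] meet_eq[OF c(1,4) join_left[OF c(1,2)]] meet_comm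
    by auto
  then have "(ji_star x, ji x) \<in> \<theta> \<longleftrightarrow> (mi x, mi_star x) \<in> \<theta>"
    using congruence_join[OF assms(1) _ c(2), of "ji_star x" "ji x"]
      congruence_meet[OF assms(1) _ c(1), of "mi x" "mi_star x"] by auto
  then show ?thesis using assms(2) by (simp add: collapsed_def)
qed

text \<open>In the first case \<open>ji_star x\<close>, but not \<open>ji x\<close>, lies below
  \<open>mi y\<close>. Joining the collapsed cover with \<open>mi y\<close> thus collapses an
  interval that starts at \<open>mi y\<close> and contains \<open>mi_star y\<close>. The second case
  is dual, meeting with \<open>ji y\<close>.\<close>

lemma collapsed_squig:
  assumes "lattice_congruence L \<theta>" "x \<in> collapsed \<theta>" "(x, y) \<in> squig S onto into"
  shows "y \<in> collapsed \<theta>"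
proof -
  have S: "x \<in> S" "y \<in> S" using assms(3) by (auto simp: squig_def)
  note cx = irreducible_carrier[OF S(1)] and cy = irreducible_carrier[OF S(2)]
  from assms(3) consider
    (F) "minimal_in onto (F_set S into y) x" | (T) "maximal_in into (T_set S onto y) x"
    by (auto simp: squig_def)
  then show ?thesis
  proof cases
    case F
    then have xy: "(x, y) \<in> into"
      and min: "\<And>x'. (x, x') \<in> onto \<Longrightarrow> (x', y) \<in> into \<Longrightarrow> x' = x"
      using into_iff by (auto simp: minimal_in_def F_set_def)
    \<comment> \<open>An arrow from \<open>z\<close> to \<open>y\<close> factors through some
      \<open>w\<close> in \<open>F_set S into y\<close> that lies \<open>onto\<close>-below
      \<open>x\<close>. Minimality gives \<open>w = x\<close>, and antisymmetry then
      \<open>z = x\<close>.\<close>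
    have "(z, y) \<notin> arr" if "(x, z) \<in> onto" "z \<noteq> x" for z
      using that min onto_trans onto_antisym arr_iff by metis
    then have le: "ji_star x \<sqsubseteq>\<^bsub>L\<^esub> mi y"
      using S by (auto simp: le_iff_fst fst_ji_star fst_mi T_set_def)
    have "x \<notin> fst (mi y)" using xy arr_iff S onto_refl unfolding fst_mi by blast
    then have "\<not> ji x \<sqsubseteq>\<^bsub>L\<^esub> mi y" using ji_le_iff S cy by blast
    then have "mi y \<sqsubset>\<^bsub>L\<^esub> ji x \<squnion>\<^bsub>L\<^esub> mi y"
      using join_left[OF cx(1) cy(2)] join_right[OF cx(1) cy(2)] by (auto simp: lless_eq)
    then have *: "mi_star y \<sqsubseteq>\<^bsub>L\<^esub> ji x \<squnion>\<^bsub>L\<^esub> mi y"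
      using mi_star_le S cx cy by auto
    have "(ji_star x \<squnion>\<^bsub>L\<^esub> mi y, ji x \<squnion>\<^bsub>L\<^esub> mi y) \<in> \<theta>"
      using assms(1,2) cy by (intro congruence_join) (auto simp: collapsed_def)
    then have "(mi y, ji x \<squnion>\<^bsub>L\<^esub> mi y) \<in> \<theta>" using join_eq[OF cx(3) cy(2) le] by simp
    then have "(mi y, mi_star y) \<in> \<theta>"
      using congruence_convex(1)[OF assms(1)] * cy mi_star_greater[OF S(2)] by (auto simp: lless_eq)
    then show ?thesis using collapsed_iff_mi assms(1) S by blast
  next
    case T
    then have yx: "(y, x) \<in> onto"
      and max: "\<And>x'. (y, x') \<in> onto \<Longrightarrow> (x', x) \<in> into \<Longrightarrow> x' = x"
      using onto_iff by (auto simp: maximal_in_def T_set_def)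
    have "(y, z) \<notin> arr" if "(z, x) \<in> into" "z \<noteq> x" for z
      using that max into_trans into_antisym arr_iff by metis
    then have le: "ji y \<sqsubseteq>\<^bsub>L\<^esub> mi_star x"
      using S by (auto simp: le_iff_snd cx cy snd_mi_star snd_ji F_set_def)
    have "x \<notin> snd (ji y)" using yx arr_iff S into_refl unfolding snd_ji by blast
    then have "\<not> ji y \<sqsubseteq>\<^bsub>L\<^esub> mi x" using le_mi_iff S cy by blast
    then have "mi x \<sqinter>\<^bsub>L\<^esub> ji y \<sqsubset>\<^bsub>L\<^esub> ji y"
      using meet_left[OF cx(2) cy(1)] meet_right[OF cx(2) cy(1)] by (auto simp: lless_eq)
    then have *: "mi x \<sqinter>\<^bsub>L\<^esub> ji y \<sqsubseteq>\<^bsub>L\<^esub> ji_star y"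
      using le_ji_star S cx cy by auto
    have "(mi x \<sqinter>\<^bsub>L\<^esub> ji y, mi_star x \<sqinter>\<^bsub>L\<^esub> ji y) \<in> \<theta>"
      using assms(1,2) cy collapsed_iff_mi S by (intro congruence_meet) auto
    then have "(mi x \<sqinter>\<^bsub>L\<^esub> ji y, ji y) \<in> \<theta>" using meet_eq[OF cy(1) cx(4) le] by simp
    then have "(ji_star y, ji y) \<in> \<theta>"
      using congruence_convex(2)[OF assms(1)] * cy ji_star_less[OF S(2)] by (auto simp: lless_eq)
    then show ?thesis using S by (simp add: collapsed_def)
  qed
qed

section \<open>Congruences from sets closed under \<open>squig\<close>\<close>

lemma ex_minimal_onto:
  assumes "A \<subseteq> S" "x \<in> A"
  shows "\<exists>z. (x, z) \<in> onto \<and> minimal_in onto A z"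
proof -
  have "finite A" using assms(1) fin finite_subset by blast
  \<comment> \<open>Well-foundedness expects the smaller element first, whereas \<open>onto\<close>
    lists the greater one first; hence the reversal.\<close>
  define r where "r = {(z', z). z' \<in> A \<and> z \<in> A \<and> (z, z') \<in> onto \<and> z \<noteq> z'}"
  have "wf r"
  proof (rule finite_acyclic_wf)
    show "finite r" by (rule finite_subset[of _ "A \<times> A"]) (use \<open>finite A\<close> in \<open>auto simp: r_def\<close>)
    have "trans r" using onto_trans onto_antisym unfolding r_def trans_def by blast
    then show "acyclic r" by (auto simp: acyclic_def r_def)
  qed
  moreover have "x \<in> {z \<in> A. (x, z) \<in> onto}" using assms onto_refl by auto
  ultimately obtain z where "z \<in> {z \<in> A. (x, z) \<in> onto}"
      "\<And>z'. (z', z) \<in> r \<Longrightarrow> z' \<notin> {z \<in> A. (x, z) \<in> onto}"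
    by (rule wfE_min) blast
  then show ?thesis using onto_trans by (intro exI[of _ z]) (auto simp: minimal_in_def r_def)
qed

lemma ex_maximal_into:
  assumes "A \<subseteq> S" "x \<in> A"
  shows "\<exists>z. (z, x) \<in> into \<and> maximal_in into A z"
proof -
  have "finite A" using assms(1) fin finite_subset by blast
  \<comment> \<open>No reversal here: minimal elements for \<open>r\<close> are to be maximal for
    \<open>into\<close>.\<close>
  define r where "r = {(z', z). z' \<in> A \<and> z \<in> A \<and> (z', z) \<in> into \<and> z \<noteq> z'}"
  have "wf r"
  proof (rule finite_acyclic_wf)
    show "finite r" by (rule finite_subset[of _ "A \<times> A"]) (use \<open>finite A\<close> in \<open>auto simp: r_def\<close>)
    have "trans r" using into_trans into_antisym unfolding r_def trans_def by blast
    then show "acyclic r" by (auto simp: acyclic_def r_def)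
  qed
  moreover have "x \<in> {z \<in> A. (z, x) \<in> into}" using assms into_refl by auto
  ultimately obtain z where "z \<in> {z \<in> A. (z, x) \<in> into}"
      "\<And>z'. (z', z) \<in> r \<Longrightarrow> z' \<notin> {z \<in> A. (z, x) \<in> into}"
    by (rule wfE_min) blast
  then show ?thesis using into_trans by (intro exI[of _ z]) (auto simp: maximal_in_def r_def)
qed

text \<open>The kernel of restricting first components to the complement of \<open>D\<close>. For
  closed \<open>D\<close> the second components define the same relation.\<close>

definition quotient_congruence :: "'a set \<Rightarrow> ('a set \<times> 'a set) rel" where
  "quotient_congruence D =
     {(P, Q). P \<in> carrier L \<and> Q \<in> carrier L \<and> fst P - D = fst Q - D}"

text \<open>Suppose \<open>x \<in> fst P\<close> has an arrow to \<open>u\<close> outside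
  \<open>D\<close>, factored through \<open>z\<close>. Descend from \<open>z\<close> to an
  \<open>onto\<close>-minimal \<open>w\<close> of \<open>F_set S into u\<close>. Then
  \<open>w\<close> is still in \<open>fst P\<close>, and it is outside \<open>D\<close> because
  \<open>(w, u)\<close> is in \<open>squig\<close> and \<open>D\<close> is closed. So elements of
  \<open>D\<close> impose no further condition on \<open>u\<close>.\<close>

lemma snd_diff_closed:
  assumes "squig S onto into `` D \<subseteq> D" "P \<in> carrier L"
  shows "snd P - D = {u \<in> S - D. \<forall>x\<in>fst P - D. (x, u) \<notin> arr}" (is "_ = ?R")
proof (intro equalityI subsetI)
  fix u assume u: "u \<in> ?R"
  have "(x, u) \<notin> arr" if x: "x \<in> fst P" for x
  proof
    assume "(x, u) \<in> arr"
    then obtain z where z: "(x, z) \<in> onto" "(z, u) \<in> into" using arr_iff by blast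
    then have "z \<in> F_set S into u" using into_iff by (auto simp: F_set_def)
    then obtain w where w: "(z, w) \<in> onto" "minimal_in onto (F_set S into u) w"
      using ex_minimal_onto[of "F_set S into u"] by (auto simp: F_set_def)
    then have wu: "(w, u) \<in> into" "w \<in> S" by (auto simp: minimal_in_def F_set_def)
    have "w \<in> fst P" using fst_onto_closed[OF assms(2)] x z w by blast
    moreover have "w \<notin> D" using assms(1) w wu u by (auto simp: squig_def)
    moreover have "(w, u) \<in> arr" using wu onto_refl arr_iff by blast
    ultimately show False using u by blast
  qed
  then show "u \<in> snd P - D"
    using u assms(2) by (auto simp: mem_snd_iff)
qed (use assms(2) in \<open>auto simp: mem_snd_iff\<close>)

text \<open>Dual to \<open>snd_diff_closed\<close>: ascend along \<open>into\<close> to a maximal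
  element of \<open>T_set S onto u\<close>, which uses the other clause of
  \<open>squig\<close>.\<close>

lemma fst_diff_closed:
  assumes "squig S onto into `` D \<subseteq> D" "P \<in> carrier L"
  shows "fst P - D = {u \<in> S - D. \<forall>y\<in>snd P - D. (u, y) \<notin> arr}" (is "_ = ?R")
proof (intro equalityI subsetI)
  fix u assume u: "u \<in> ?R"
  have "(u, y) \<notin> arr" if y: "y \<in> snd P" for y
  proof
    assume "(u, y) \<in> arr"
    then obtain z where z: "(u, z) \<in> onto" "(z, y) \<in> into" using arr_iff by blast
    then have "z \<in> T_set S onto u" using onto_iff by (auto simp: T_set_def)
    then obtain w where w: "(w, z) \<in> into" "maximal_in into (T_set S onto u) w"
      using ex_maximal_into[of "T_set S onto u"] by (auto simp: T_set_def)
    then have wu: "(u, w) \<in> onto" "w \<in> S" by (auto simp: maximal_in_def T_set_def)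
    have "w \<in> snd P" using snd_into_closed[OF assms(2)] y z w by blast
    moreover have "w \<notin> D" using assms(1) w wu u by (auto simp: squig_def)
    moreover have "(u, w) \<in> arr" using wu into_refl arr_iff by blast
    ultimately show False using u by blast
  qed
  then show "u \<in> fst P - D"
    using u assms(2) by (auto simp: mem_fst_iff)
qed (use assms(2) in \<open>auto simp: mem_fst_iff\<close>)

lemma lattice_congruence_quotient_congruence:
  assumes "squig S onto into `` D \<subseteq> D"
  shows "lattice_congruence L (quotient_congruence D)"
proof -
  \<comment> \<open>Meets are intersections of first components and joins of second ones, so
    compatibility with both needs the two descriptions of the relation.\<close>
  have iff: "fst P - D = fst Q - D \<longleftrightarrow> snd P - D = snd Q - D"
    if "P \<in> carrier L" "Q \<in> carrier L" for P Q
  proof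
    assume "fst P - D = fst Q - D"
    then show "snd P - D = snd Q - D" by (simp only: snd_diff_closed[OF assms] that)
  next
    assume "snd P - D = snd Q - D"
    then show "fst P - D = fst Q - D" by (simp only: fst_diff_closed[OF assms] that)
  qed
  have "equiv (carrier L) (quotient_congruence D)"
    by (rule equivI)
      (auto simp: quotient_congruence_def refl_on_def sym_def trans_def)
  moreover have "(P \<squnion>\<^bsub>L\<^esub> Q, P' \<squnion>\<^bsub>L\<^esub> Q') \<in> quotient_congruence D"
      "(P \<sqinter>\<^bsub>L\<^esub> Q, P' \<sqinter>\<^bsub>L\<^esub> Q') \<in> quotient_congruence D"
    if PQ: "(P, P') \<in> quotient_congruence D" "(Q, Q') \<in> quotient_congruence D" for P P' Q Q'
  proof -
    have c: "P \<in> carrier L" "P' \<in> carrier L" "Q \<in> carrier L" "Q' \<in> carrier L"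
      and f: "fst P - D = fst P' - D" "fst Q - D = fst Q' - D"
      using PQ by (auto simp: quotient_congruence_def)
    then have "snd P - D = snd P' - D" "snd Q - D = snd Q' - D" using iff by auto
    then have "snd (P \<squnion>\<^bsub>L\<^esub> Q) - D = snd (P' \<squnion>\<^bsub>L\<^esub> Q') - D" using c by (simp add: snd_join) blast
    then show "(P \<squnion>\<^bsub>L\<^esub> Q, P' \<squnion>\<^bsub>L\<^esub> Q') \<in> quotient_congruence D"
      using c iff by (simp add: quotient_congruence_def)
    have "fst (P \<sqinter>\<^bsub>L\<^esub> Q) - D = fst (P' \<sqinter>\<^bsub>L\<^esub> Q') - D" using c f by (simp add: fst_meet) blast
    then show "(P \<sqinter>\<^bsub>L\<^esub> Q, P' \<sqinter>\<^bsub>L\<^esub> Q') \<in> quotient_congruence D"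
      using c by (simp add: quotient_congruence_def)
  qed
  ultimately show ?thesis unfolding lattice_congruence_def by blast
qed

text \<open>The first components of \<open>ji x\<close> and \<open>ji_star x\<close> differ in
  \<open>x\<close> alone. Hence every closed subset of \<open>S\<close> is the code of a
  congruence.\<close>

lemma collapsed_quotient_congruence:
  assumes "D \<subseteq> S"
  shows "collapsed (quotient_congruence D) = D"
proof -
  have "(ji_star x, ji x) \<in> quotient_congruence D \<longleftrightarrow> x \<in> D" if "x \<in> S" for x
    using that onto_refl
    by (auto simp: quotient_congruence_def irreducible_carrier fst_ji_star fst_ji T_set_def)
  then show ?thesis using assms by (auto simp: collapsed_def)
qed

text \<open>Climbs from \<open>P\<close> to \<open>Q\<close> by joining one \<open>ji x\<close> at a
  time. Each step is the image of a cover that \<open>\<theta>\<close>, and therefore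
  \<open>\<phi>\<close>, collapses.\<close>

lemma collapsed_subset_chain:
  assumes "lattice_congruence L \<theta>" "lattice_congruence L \<phi>" "collapsed \<theta> \<subseteq> collapsed \<phi>"
    and "(P, Q) \<in> \<theta>" "P \<sqsubseteq>\<^bsub>L\<^esub> Q"
  shows "(P, Q) \<in> \<phi>"
  using assms(4,5)
proof (induction "card (fst Q - fst P)" arbitrary: P rule: less_induct)
  case less
  have c: "P \<in> carrier L" "Q \<in> carrier L" using congruence_carrier assms(1) less.prems by blast+
  show ?case
  proof (cases "P = Q")
    case True
    then show ?thesis using congruence_refl assms(2) c by blast
  next
    case False
    then have "fst Q - fst P \<noteq> {}" using less.prems c by (auto simp: le_iff_fst pair_eq_iff_fst)
    moreover have QS: "fst Q - fst P \<subseteq> S" using fst_subset c by blast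
    ultimately obtain x where "minimal_in onto (fst Q - fst P) x" using ex_minimal_onto by blast
    then have x: "x \<in> fst Q" "x \<notin> fst P" "x \<in> S"
      and min: "\<And>x'. (x, x') \<in> onto \<Longrightarrow> x' \<noteq> x \<Longrightarrow> x' \<in> fst Q \<Longrightarrow> x' \<in> fst P"
      using QS by (auto simp: minimal_in_def)
    note cx = irreducible_carrier[OF x(3)]
    have jQ: "ji x \<sqsubseteq>\<^bsub>L\<^esub> Q" using ji_le_iff x c by blast
    \<comment> \<open>Everything \<open>onto\<close>-below \<open>x\<close> lies in
      \<open>fst Q\<close>, and by the minimal choice of \<open>x\<close> all of it except
      \<open>x\<close> lies in \<open>fst P\<close>.\<close>
    have jP: "ji_star x \<sqsubseteq>\<^bsub>L\<^esub> P"
      using min fst_onto_closed[OF c(2) x(1)] x(3) by (auto simp: le_iff_fst fst_ji_star T_set_def)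
    have "P \<sqinter>\<^bsub>L\<^esub> ji x = ji_star x"
      using cx c jP x by (auto simp: pair_eq_iff_fst fst_meet[of P] fst_ji_star fst_ji le_iff_fst)
    moreover have "(P \<sqinter>\<^bsub>L\<^esub> ji x, Q \<sqinter>\<^bsub>L\<^esub> ji x) \<in> \<theta>"
      using congruence_meet assms(1) less.prems cx by blast
    ultimately have "(ji_star x, ji x) \<in> \<theta>" using meet_eq[OF cx(1) c(2) jQ] by simp
    then have "(ji_star x, ji x) \<in> \<phi>" using assms(3) x by (auto simp: collapsed_def)
    then have "(ji_star x \<squnion>\<^bsub>L\<^esub> P, ji x \<squnion>\<^bsub>L\<^esub> P) \<in> \<phi>" using congruence_join assms(2) c by blast
    then have 1: "(P, ji x \<squnion>\<^bsub>L\<^esub> P) \<in> \<phi>" using join_eq[OF cx(3) c(1) jP] by simp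
    let ?P = "ji x \<squnion>\<^bsub>L\<^esub> P"
    have P': "?P \<in> carrier L" "?P \<sqsubseteq>\<^bsub>L\<^esub> Q" "P \<sqsubseteq>\<^bsub>L\<^esub> ?P" "ji x \<sqsubseteq>\<^bsub>L\<^esub> ?P"
      using cx c jQ less.prems join_le[of "ji x" Q P] join_left[of "ji x" P] join_right[of "ji x" P]
      by auto
    then have "x \<in> fst ?P" using ji_le_iff x by blast
    then have "fst Q - fst ?P \<subset> fst Q - fst P" using x P'(3) by (auto simp: le_iff_fst)
    then have "card (fst Q - fst ?P) < card (fst Q - fst P)"
      using QS fin finite_subset by (intro psubset_card_mono) blast+
    moreover have "(?P, Q) \<in> \<theta>" using congruence_convex(2) assms(1) less.prems P' by blast
    ultimately have "(?P, Q) \<in> \<phi>" using less.hyps P' by blast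
    then show ?thesis using 1 congruence_trans assms(2) by blast
  qed
qed

lemma congruence_subset_iff:
  assumes "lattice_congruence L \<theta>" "lattice_congruence L \<phi>"
  shows "\<theta> \<subseteq> \<phi> \<longleftrightarrow> collapsed \<theta> \<subseteq> collapsed \<phi>"
proof
  assume sub: "collapsed \<theta> \<subseteq> collapsed \<phi>"
  show "\<theta> \<subseteq> \<phi>"
  proof (rule subrelI)
    fix P Q assume PQ: "(P, Q) \<in> \<theta>"
    then have c: "P \<in> carrier L" "Q \<in> carrier L" using congruence_carrier assms(1) by blast+
    \<comment> \<open>Both elements are congruent to their meet, which reduces the claim to
      comparable pairs.\<close>
    let ?M = "P \<sqinter>\<^bsub>L\<^esub> Q"
    have "(?M, Q) \<in> \<theta>" using congruence_meet[OF assms(1) PQ c(2)] meet_eq[of Q Q] c by simp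
    moreover have "(?M, P) \<in> \<theta>"
      using calculation PQ congruence_sym congruence_trans assms(1) by blast
    ultimately have "(?M, Q) \<in> \<phi>" "(?M, P) \<in> \<phi>"
      using collapsed_subset_chain[OF assms sub] meet_left[OF c] meet_right[OF c] by blast+
    then show "(P, Q) \<in> \<phi>" using congruence_sym congruence_trans assms(2) by blast
  qed
qed (auto simp: collapsed_def)

section \<open>Congruences generated by a single cover\<close>

definition jcon :: "'a \<Rightarrow> ('a set \<times> 'a set) rel" where
  "jcon x = con L (ji_star x) (ji x)"

lemma jcon_congruence: "x \<in> S \<Longrightarrow> lattice_congruence L (jcon x)"
  using con_least[OF lattice_axioms, of "ji_star x" "ji x"] irreducible_carrier
  by (auto simp: jcon_def least_def Con_def)

lemma jcon_subset_iff:
  assumes "x \<in> S" "lattice_congruence L \<phi>"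
  shows "jcon x \<subseteq> \<phi> \<longleftrightarrow> x \<in> collapsed \<phi>"
  using con_least[OF lattice_axioms, of "ji_star x" "ji x"] irreducible_carrier assms
  by (auto simp: jcon_def least_def Con_def Lower_def collapsed_def)

text \<open>The same congruences collapse either cover, so one family indexed by \<open>S\<close>
  serves both maps in the definition of congruence uniformity.\<close>

lemma jcon_eq_con_mi:
  assumes "x \<in> S"
  shows "jcon x = con L (mi x) (mi_star x)"
proof -
  have "{\<phi> \<in> carrier (Con L). (ji_star x, ji x) \<in> \<phi>} = {\<phi> \<in> carrier (Con L). (mi x, mi_star x) \<in> \<phi>}"
    using collapsed_iff_mi assms by (auto simp: Con_def collapsed_def)
  then show ?thesis by (simp add: jcon_def con_def)
qed

lemma collapsed_rtrancl:
  assumes "lattice_congruence L \<theta>" "x \<in> collapsed \<theta>" "(x, y) \<in> (squig S onto into)\<^sup>*"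
  shows "y \<in> collapsed \<theta>"
  using assms(3,2) by (induction) (use collapsed_squig assms(1) in blast)+

lemma rtrancl_in_S: "x \<in> S \<Longrightarrow> (x, y) \<in> (squig S onto into)\<^sup>* \<Longrightarrow> y \<in> S"
  by (erule rtranclE) (auto simp: squig_def)

text \<open>The reachable set is closed, so its quotient congruence collapses \<open>x\<close> and
  contains \<open>jcon x\<close>. Conversely, the code of \<open>jcon x\<close> contains
  \<open>x\<close> and is closed under \<open>squig\<close>.\<close>

lemma collapsed_jcon:
  assumes "x \<in> S"
  shows "collapsed (jcon x) = (squig S onto into)\<^sup>* `` {x}" (is "_ = ?U")
proof (intro equalityI)
  have U: "squig S onto into `` ?U \<subseteq> ?U" "?U \<subseteq> S"
    using rtrancl_in_S[OF assms] by (auto intro: rtrancl_into_rtrancl)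
  then have "jcon x \<subseteq> quotient_congruence ?U"
    using jcon_subset_iff[OF assms lattice_congruence_quotient_congruence[OF U(1)]]
      collapsed_quotient_congruence by auto
  then show "collapsed (jcon x) \<subseteq> ?U"
    using collapsed_quotient_congruence[OF U(2)] unfolding collapsed_def by auto
  show "?U \<subseteq> collapsed (jcon x)"
    using collapsed_rtrancl[OF jcon_congruence] jcon_subset_iff[OF assms jcon_congruence] assms
    by blast
qed

lemma jcon_eq_iff:
  assumes "x \<in> S" "y \<in> S"
  shows "jcon x = jcon y \<longleftrightarrow> (x, y) \<in> (squig S onto into)\<^sup>* \<and> (y, x) \<in> (squig S onto into)\<^sup>*"
  using jcon_subset_iff[OF assms(1) jcon_congruence[OF assms(2)]]
    jcon_subset_iff[OF assms(2) jcon_congruence[OF assms(1)]] collapsed_jcon assms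
  by auto

text \<open>Equality of generated congruences is mutual reachability, so injectivity is antisymmetry
  of the reachability preorder; with loops removed this is acyclicity.\<close>

lemma inj_on_jcon_iff: "inj_on jcon S \<longleftrightarrow> acyclic_except_loops (squig S onto into)"
proof -
  let ?q = "squig S onto into"
  have "inj_on jcon S \<longleftrightarrow> (\<forall>x\<in>S. \<forall>y\<in>S. (x, y) \<in> ?q\<^sup>* \<and> (y, x) \<in> ?q\<^sup>* \<longrightarrow> x = y)"
    using jcon_eq_iff by (auto simp: inj_on_def)
  also have "\<dots> \<longleftrightarrow> antisym ((?q - Id)\<^sup>*)"
  proof -
    have "?q \<subseteq> S \<times> S" by (auto simp: squig_def)
    \<comment> \<open>A path between distinct elements has a first and a last edge, so both ends lie
      in \<open>S\<close> and the quantifiers need no bound.\<close>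
    then have "x \<in> S \<and> y \<in> S" if "(x, y) \<in> ?q\<^sup>*" "x \<noteq> y" for x y
      using that by (metis SigmaD1 SigmaD2 converse_rtranclE rtranclE subsetD)
    then show ?thesis by (auto simp: antisym_def rtrancl_r_diff_Id)
  qed
  also have "\<dots> \<longleftrightarrow> acyclic (?q - Id)"
  proof
    assume a: "antisym ((?q - Id)\<^sup>*)"
    show "acyclic (?q - Id)"
    proof (rule acyclicI, intro allI notI)
      fix x assume "(x, x) \<in> (?q - Id)\<^sup>+"
      then obtain y where "(x, y) \<in> ?q - Id" "(y, x) \<in> (?q - Id)\<^sup>*" by (auto dest: tranclD)
      then show False using a by (auto dest: antisymD)
    qed
  qed (rule acyclic_impl_antisym_rtrancl)
  finally show ?thesis by (simp add: acyclic_except_loops_def)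
qed

text \<open>Gives surjectivity of both maps without assuming acyclicity. A join-irreducible
  congruence is generated by any cover that it collapses and its unique lower cover does
  not.\<close>

lemma Ji_Con: "Ji (Con L) = jcon ` S"
proof -
  interpret C: partial_order "Con L" by unfold_locales (auto simp: Con_def)
  have carr: "\<theta> \<in> carrier (Con L) \<longleftrightarrow> lattice_congruence L \<theta>" for \<theta> by (simp add: Con_def)
  have less: "\<theta> \<sqsubset>\<^bsub>Con L\<^esub> \<phi> \<longleftrightarrow> \<theta> \<subset> \<phi>" for \<theta> \<phi> by (auto simp: Con_def lless_def)
  have le: "\<theta> \<sqsubseteq>\<^bsub>Con L\<^esub> \<phi> \<longleftrightarrow> \<theta> \<subseteq> \<phi>" for \<theta> \<phi> by (auto simp: Con_def)
  have "carrier (Con L) \<subseteq> Pow (carrier L \<times> carrier L)"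
    by (intro subsetI) (auto simp: carr dest: congruence_carrier)
  then have fin: "finite (carrier (Con L))"
    by (rule finite_subset) (simp add: finite_carrier)
  show ?thesis
  proof (intro equalityI subsetI)
    fix \<theta> assume "\<theta> \<in> Ji (Con L)"
    then have \<theta>: "\<theta> \<in> carrier (Con L)" "\<exists>!a. covered_by (Con L) a \<theta>" by (auto simp: Ji_def)
    then obtain \<phi> where \<phi>: "lattice_congruence L \<phi>" "\<phi> \<subset> \<theta>"
      and below: "\<And>\<psi>. lattice_congruence L \<psi> \<Longrightarrow> \<psi> \<subset> \<theta> \<Longrightarrow> \<psi> \<subseteq> \<phi>"
      using iffD1[OF C.ex1_covered_by_iff[OF fin \<theta>(1)] \<theta>(2)]
      unfolding Bex_def Ball_def carr less le by blast
    have \<theta>c: "lattice_congruence L \<theta>" using \<theta>(1) carr by blast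
    then obtain x where x: "x \<in> collapsed \<theta>" "x \<notin> collapsed \<phi>"
      using congruence_subset_iff \<phi> by blast
    then have xS: "x \<in> S" by (simp add: collapsed_def)
    have "jcon x \<subseteq> \<theta>" "\<not> jcon x \<subseteq> \<phi>" using jcon_subset_iff xS x \<theta>c \<phi> by blast+
    then have "jcon x = \<theta>" using below jcon_congruence xS by blast
    then show "\<theta> \<in> jcon ` S" using xS by blast
  next
    fix \<theta> assume "\<theta> \<in> jcon ` S"
    then obtain x where x: "x \<in> S" "\<theta> = jcon x" by blast
    let ?q = "squig S onto into"
    \<comment> \<open>The reachable set minus the strong component of \<open>x\<close>: the largest
      closed subset of it that omits \<open>x\<close>. Its quotient congruence is the greatest one
      strictly below \<open>\<theta>\<close>.\<close>
    define E where "E = {y. (x, y) \<in> ?q\<^sup>* \<and> (y, x) \<notin> ?q\<^sup>*}"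
    have ES: "E \<subseteq> S" using rtrancl_in_S[OF x(1)] by (auto simp: E_def)
    have Ecl: "?q `` E \<subseteq> E"
      by (auto simp: E_def intro: rtrancl_into_rtrancl converse_rtrancl_into_rtrancl)
    let ?\<phi> = "quotient_congruence E"
    have \<phi>: "lattice_congruence L ?\<phi>" using lattice_congruence_quotient_congruence[OF Ecl] .
    have \<theta>: "lattice_congruence L \<theta>" using x jcon_congruence by blast
    have "E \<subset> collapsed \<theta>" using collapsed_jcon[OF x(1)] by (auto simp: E_def x(2))
    then have "?\<phi> \<subset> \<theta>"
      using congruence_subset_iff[OF \<phi> \<theta>] congruence_subset_iff[OF \<theta> \<phi>]
        collapsed_quotient_congruence[OF ES] by blast
    moreover have "\<psi> \<subseteq> ?\<phi>" if \<psi>: "lattice_congruence L \<psi>" "\<psi> \<subset> \<theta>" for \<psi>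
    proof -
      \<comment> \<open>Collapsing \<open>x\<close> would force \<open>\<psi>\<close> to contain all
        of \<open>\<theta>\<close>; so \<open>\<psi>\<close> collapses nothing from which
        \<open>x\<close> can be reached.\<close>
      have "x \<notin> collapsed \<psi>" using jcon_subset_iff[OF x(1) \<psi>(1)] \<psi>(2) x(2) by blast
      then have "(y, x) \<notin> ?q\<^sup>*" if "y \<in> collapsed \<psi>" for y
        using collapsed_rtrancl[OF \<psi>(1) that] by blast
      moreover have "collapsed \<psi> \<subseteq> collapsed \<theta>" using congruence_subset_iff[OF \<psi>(1) \<theta>] \<psi>(2) by blast
      ultimately have "collapsed \<psi> \<subseteq> E" using collapsed_jcon[OF x(1)] by (auto simp: E_def x(2))
      then show ?thesis
        using congruence_subset_iff[OF \<psi>(1) \<phi>] collapsed_quotient_congruence[OF ES] by blast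
    qed
    ultimately have "\<exists>!a. covered_by (Con L) a \<theta>"
      using C.ex1_covered_by_iff[OF fin, of \<theta>] \<phi> \<theta>
      unfolding Bex_def Ball_def carr less le by blast
    then show "\<theta> \<in> Ji (Con L)" using \<theta> by (simp add: Ji_def carr)
  qed
qed

text \<open>Reindexing along \<open>g\<close> treats join- and meet-irreducibles alike; as
  \<open>Ji_Con\<close> supplies surjectivity, only injectivity remains.\<close>

lemma bij_betw_jcon_iff:
  assumes "inj_on g S" "\<And>x. x \<in> S \<Longrightarrow> f (g x) = jcon x"
  shows "bij_betw f (g ` S) (Ji (Con L)) \<longleftrightarrow> inj_on jcon S"
proof -
  have "bij_betw f (g ` S) (Ji (Con L)) \<longleftrightarrow> bij_betw (f \<circ> g) S (Ji (Con L))"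
    using assms(1) bij_betw_comp_iff[of g S "g ` S" f] by (simp add: bij_betw_def)
  also have "\<dots> \<longleftrightarrow> bij_betw jcon S (Ji (Con L))"
    by (rule bij_betw_cong) (simp add: assms(2))
  also have "\<dots> \<longleftrightarrow> inj_on jcon S"
    by (simp add: bij_betw_def Ji_Con)
  finally show ?thesis .
qed

lemma congruence_uniform_iff:
  "congruence_uniform L \<longleftrightarrow> acyclic_except_loops (squig S onto into)"
proof -
  have "bij_betw (\<lambda>j. con L (lower_star L j) j) (Ji L) (Ji (Con L)) \<longleftrightarrow> inj_on jcon S"
    unfolding Ji_eq by (rule bij_betw_jcon_iff[OF inj_on_ji]) (simp add: lower_star_ji jcon_def)
  moreover have "bij_betw (\<lambda>m. con L m (upper_star L m)) (Mi L) (Ji (Con L)) \<longleftrightarrow> inj_on jcon S"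
    unfolding Mi_eq by (rule bij_betw_jcon_iff[OF inj_on_mi]) (simp add: upper_star_mi jcon_eq_con_mi)
  ultimately show ?thesis
    using lattice_axioms finite_carrier inj_on_jcon_iff by (simp add: congruence_uniform_def)
qed

end

theorem corollary7p4:
  fixes S :: "'a set" and arr onto into :: "'a rel"
  assumes "finite S"
    and "factorization_system S arr onto into"
    and "two_acyclic onto into"
  shows "congruence_uniform (Pairs S arr) \<longleftrightarrow> acyclic_except_loops (squig S onto into)"
proof -
  interpret two_acyclic_factorization_system S arr onto into
    using assms by unfold_locales
  show ?thesis by (rule congruence_uniform_iff)
qed

end
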